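(* Let $q$ be a prime power and let $m,t,e$ be positive integers with $e > mt/2$. Then $\mathbb{F}_q[x]$ contains an irreducible polynomial $f$ such that $\deg(f)=m$ and $f(x^t)$ has an irreducible (over $\mathbb{F}_q$) factor of degree $e$ if and only if $\gcd(t,q)=1$ and $\mathrm{ord}(q;(q^m-1)t)=e$.
   Context: $\mathbb{F}_q$ is the finite field with $q$ elements. For coprime positive integers $a,r$, $\mathrm{ord}(a;r)$ denotes the smallest positive integer $n$ such that $r$ divides $a^n-1$ (so $\mathrm{ord}(a;1)=1$). *)

theory Defs
  imports
    "HOL-Library.Cardinality"
    "HOL-Computational_Algebra.Computational_Algebra"
    "HOL-Number_Theory.Number_Theory"
begin

text \<open>
  The finite field with \<open>q\<close> elements is rendered as an arbitrary type of class
  \<open>finite_field\<close> whose cardinality is \<open>q\<close>; being the cardinality of a finite field,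
  \<open>q\<close> is automatically a prime power.
  Beware of the argument order and of the non-coprime case in the library's
  multiplicative order: \<open>ord r a\<close> is the least \<open>n > 0\<close> with
  \<open>[a ^ n = 1] (mod r)\<close> when \<open>a\<close> and \<open>r\<close> are coprime (so \<open>ord 1 a = 1\<close>), and \<open>0\<close> otherwise.
\<close>

end

theory Submission
  imports Defs "HOL-Algebra.Algebraic_Closure_Type" "HOL-Algebra.Sylow"
begin

text \<open>
  Let \<open>x\<close>, in an algebraic closure, be a root of an irreducible \<open>g\<close>. Then \<open>x^(q^n) = x\<close> holds iff
  \<open>degree g\<close> divides \<open>n\<close>. Put \<open>E = ord ((q^m - 1) * t) q\<close>.

  If \<open>x \<noteq> 0\<close> and \<open>x^t\<close> is a root of an irreducible \<open>f\<close> of degree \<open>m\<close>, then \<open>x^((q^m - 1) * t) = 1\<close>,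
  so \<open>e = degree g\<close> divides \<open>E\<close>. If \<open>t\<close> is prime to \<open>q\<close>, a pigeonhole argument gives
  \<open>E \<le> m * t < 2 * e\<close>, which forces \<open>E = e\<close>. If the characteristic \<open>p\<close> divides \<open>t\<close>, injectivity
  of the Frobenius map shows that \<open>x^(t / p)\<close> already has degree at most \<open>m\<close>, so
  \<open>e \<le> m * t / p \<le> m * t / 2\<close>.

  Conversely, the closure contains an element \<open>z\<close> of order \<open>(q^m - 1) * t\<close>, and one takes for
  \<open>g\<close> and \<open>f\<close> the minimal polynomials of \<open>z\<close> and \<open>z^t\<close>.
\<close>

hide_const (open) Divisibility.irreducible Divisibility.prime Polynomials.degree

section \<open>Evaluation of polynomials at elements of the algebraic closure\<close>

text \<open>Divisibility and irreducibility stay over the base field, while values live in the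
  closure.\<close>

definition ac_poly :: "'a :: field poly \<Rightarrow> 'a alg_closure \<Rightarrow> 'a alg_closure" where
  "ac_poly p x = poly (map_poly to_ac p) x"

lemma ac_poly_0 [simp]: "ac_poly 0 x = 0"
  by (simp add: ac_poly_def)

lemma ac_poly_pCons [simp]: "ac_poly (pCons a p) x = to_ac a + x * ac_poly p x"
  by (simp add: ac_poly_def map_poly_pCons)

lemma ac_poly_1 [simp]: "ac_poly 1 x = 1"
  by (simp add: ac_poly_def)

lemma ac_poly_monom [simp]: "ac_poly (Polynomial.monom c n) x = to_ac c * x ^ n"
  by (simp add: ac_poly_def map_poly_monom poly_monom)

lemma ac_poly_add [simp]: "ac_poly (p + r) x = ac_poly p x + ac_poly r x"
  by (induction p r rule: poly_induct2) (simp_all add: algebra_simps)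

lemma ac_poly_diff [simp]: "ac_poly (p - r) x = ac_poly p x - ac_poly r x"
  by (metis ac_poly_add add_diff_cancel_right' diff_add_cancel)

lemma ac_poly_smult [simp]: "ac_poly (Polynomial.smult c p) x = to_ac c * ac_poly p x"
  by (induction p) (simp_all add: algebra_simps)

lemma ac_poly_mult [simp]: "ac_poly (p * r) x = ac_poly p x * ac_poly r x"
  by (induction p) (simp_all add: algebra_simps)

lemma ac_poly_pcompose: "ac_poly (pcompose p r) x = ac_poly p (ac_poly r x)"
  by (induction p) (simp_all add: pcompose_pCons algebra_simps)

lemma ac_poly_mod:
  assumes "ac_poly g x = 0"
  shows "ac_poly (p mod g) x = ac_poly p x"
proof -
  have "ac_poly p x = ac_poly (p div g * g + p mod g) x"
    by simp
  also have "\<dots> = ac_poly (p mod g) x"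
    using assms by (simp only: ac_poly_add ac_poly_mult) simp
  finally show ?thesis ..
qed

section \<open>Minimal polynomials\<close>

text \<open>Take a nonzero polynomial of least degree vanishing at \<open>x\<close>. Division with
  remainder gives the divisibility, and the absence of zero divisors in the closure gives
  irreducibility.\<close>

lemma minimal_polynomial_exists:
  fixes x :: "'a :: field alg_closure"
  obtains h :: "'a poly" where "irreducible h" "\<And>p. ac_poly p x = 0 \<longleftrightarrow> h dvd p"
proof -
  obtain p0 :: "'a poly" where "p0 \<noteq> 0 \<and> ac_poly p0 x = 0"
    using alg_closure_algebraic[of x] by (auto simp: ac_poly_def)
  then obtain h where h: "h \<noteq> 0" "ac_poly h x = 0"
    and least: "\<And>p. p \<noteq> 0 \<Longrightarrow> ac_poly p x = 0 \<Longrightarrow> degree h \<le> degree p"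
    using ex_has_least_nat[of "\<lambda>p. p \<noteq> 0 \<and> ac_poly p x = 0" p0 degree] by blast
  have dvd: "h dvd p" if "ac_poly p x = 0" for p
  proof (rule ccontr)
    assume "\<not> h dvd p"
    hence "p mod h \<noteq> 0"
      by (simp add: dvd_eq_mod_eq_0)
    thus False
      using least[of "p mod h"] that h degree_mod_less'[of h p] by (simp add: ac_poly_mod)
  qed
  have iff: "ac_poly p x = 0 \<longleftrightarrow> h dvd p" for p
    using h dvd by (auto elim!: dvdE)
  have "irreducible h"
  proof (rule Factorial_Ring.irreducibleI)
    show "\<not> h dvd 1"
      using iff[of 1] by simp
  next
    fix a b assume ab: "h = a * b"
    hence "ac_poly a x = 0 \<or> ac_poly b x = 0"
      using h by simp
    \<comment> \<open>The factors 1 are written out so that the cancellation laws for divisibility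
      apply.\<close>
    hence "a * b dvd a * 1 \<or> a * b dvd 1 * b"
      using dvd ab by (metis mult_1_left mult_1_right)
    thus "a dvd 1 \<or> b dvd 1"
      using h ab by (metis dvd_mult_cancel_left dvd_mult_cancel_right mult_zero_left mult_zero_right)
  qed (use h in auto)
  thus ?thesis
    using iff that by blast
qed

text \<open>The minimal polynomial \<open>h\<close> of \<open>x\<close> divides \<open>g\<close>;
  irreducibility makes the cofactor a unit, so \<open>g\<close> and \<open>h\<close> have the same
  multiples.\<close>

lemma irreducible_dvd_iff_root:
  fixes g :: "'a :: field poly"
  assumes "irreducible g" "ac_poly g x = 0"
  shows "ac_poly p x = 0 \<longleftrightarrow> g dvd p"
proof -
  obtain h :: "'a poly" where h: "irreducible h" "\<And>p. ac_poly p x = 0 \<longleftrightarrow> h dvd p"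
    using minimal_polynomial_exists[of x] by blast
  obtain c where c: "g = h * c"
    using h(2) assms(2) by (auto elim: dvdE)
  have "c dvd 1"
    using Factorial_Ring.irreducibleD[OF assms(1) c] h(1) by (auto simp: irreducible_not_unit)
  hence "g dvd h"
    using c by (metis dvd_refl mult_dvd_mono mult.right_neutral)
  thus ?thesis
    using h c by (metis dvd_trans dvd_triv_left)
qed

lemma irreducible_degree_pos:
  fixes g :: "'a :: field poly"
  assumes "irreducible g"
  shows "degree g > 0"
  using assms by (metis Factorial_Ring.irreducible_def gr0I is_unit_iff_degree)

lemma irreducible_has_root:
  fixes g :: "'a :: field poly"
  assumes "irreducible g"
  obtains x where "ac_poly g x = 0"
  using alg_closed_imp_poly_has_root[of "map_poly to_ac g"] irreducible_degree_pos[OF assms]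
  by (auto simp: ac_poly_def degree_map_poly)

section \<open>Cardinality, characteristic and the Frobenius map\<close>

lemma card_UNIV_field_ge_2: "CARD('a :: finite_field) \<ge> 2"
  using card_mono[of UNIV "{0, 1 :: 'a}"] by simp

text \<open>Cauchy's theorem: the additive group contains an element of order \<open>l\<close>.\<close>
lemma prime_dvd_CARD_imp_eq_CHAR:
  assumes "prime l" "l dvd CARD('a :: finite_field)"
  shows "l = CHAR('a)"
proof (rule ccontr)
  assume "l \<noteq> CHAR('a)"
  hence "\<not> CHAR('a) dvd l"
    using assms(1) CHAR_prime[where 'a = 'a] primes_dvd_imp_eq by metis
  hence nz: "of_nat l \<noteq> (0 :: 'a)"
    by (simp add: of_nat_eq_0_iff_char_dvd)
  define G where "G = \<lparr>carrier = (UNIV :: 'a set), monoid.mult = ((+) :: 'a \<Rightarrow> 'a \<Rightarrow> 'a), one = (0 :: 'a)\<rparr>"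
  have G: "group G"
  proof (rule groupI)
    fix x assume "x \<in> carrier G"
    show "\<exists>y\<in>carrier G. y \<otimes>\<^bsub>G\<^esub> x = \<one>\<^bsub>G\<^esub>"
      by (rule bexI[of _ "-x"]) (auto simp: G_def)
  qed (auto simp: G_def add_ac)
  obtain n where "CARD('a) = l * n"
    using assms(2) by (auto elim: dvdE)
  hence "order G = l ^ 1 * n"
    by (simp add: order_def G_def)
  then obtain H where H: "subgroup H G" "card H = l"
    using sylow_thm[OF assms(1) G, of 1 n] by (auto simp: G_def)
  have pow: "x [^]\<^bsub>G\<^esub> k = of_nat k * x" for x :: 'a and k :: nat
    by (induction k) (auto simp: G_def algebra_simps)
  have "x = 0" if "x \<in> H" for x
  proof -
    have "x [^]\<^bsub>G\<lparr>carrier := H\<rparr>\<^esub> l = \<one>\<^bsub>G\<lparr>carrier := H\<rparr>\<^esub>"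
      using group.pow_order_eq_1[OF group.subgroup_imp_group[OF G H(1)], of x] that H(2)
      by (simp add: order_def)
    hence "x [^]\<^bsub>G\<^esub> l = \<one>\<^bsub>G\<^esub>"
      by (simp add: nat_pow_def)
    thus ?thesis
      using nz by (simp add: pow) (simp add: G_def)
  qed
  hence "H \<subseteq> {0}"
    by auto
  hence "card H \<le> 1"
    using card_mono[of "{0}" H] by simp
  thus False
    using H(2) prime_ge_2_nat[OF assms(1)] by simp
qed

text \<open>After all factors \<open>CHAR('a)\<close> are split off, a prime divisor of the cofactor
  would again be the characteristic. The result makes taking \<open>q\<close>-th powers
  additive.\<close>

lemma CARD_eq_CHAR_power:
  obtains k where "CARD('a :: finite_field) = CHAR('a) ^ k"
proof -
  obtain u where u: "CARD('a) = CHAR('a) ^ multiplicity CHAR('a) CARD('a) * u" "\<not> CHAR('a) dvd u"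
    using multiplicity_decompose'[of "CARD('a)" "CHAR('a)"] CHAR_prime[where 'a = 'a]
    by (auto simp: not_prime_unit)
  have "u = 1"
  proof (rule ccontr)
    assume "u \<noteq> 1"
    then obtain l where l: "prime l" "l dvd u"
      using prime_factor_nat by blast
    hence "l dvd CARD('a)"
      by (subst u(1)) simp
    hence "l = CHAR('a)"
      by (rule prime_dvd_CARD_imp_eq_CHAR[OF l(1)])
    thus False
      using l u by simp
  qed
  thus ?thesis
    using u(1) that by simp
qed

lemma alg_closure_power_card_power_add:
  fixes x y :: "'a :: finite_field alg_closure"
  shows "(x + y) ^ (CARD('a) ^ n) = x ^ (CARD('a) ^ n) + y ^ (CARD('a) ^ n)"
proof -
  obtain k where "CARD('a) = CHAR('a) ^ k"
    using CARD_eq_CHAR_power .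
  thus ?thesis
    using freshmans_dream'[where 'a = "'a alg_closure", of "CARD('a) ^ n" "k * n"]
    by (simp add: power_mult)
qed

text \<open>The power map is a ring homomorphism that fixes the coefficients, so it commutes with
  evaluation.\<close>

lemma ac_poly_power_card_power:
  fixes p :: "'a :: finite_field poly"
  shows "ac_poly p x ^ (CARD('a) ^ n) = ac_poly p (x ^ (CARD('a) ^ n))"
proof (induction p)
  case (pCons a p)
  have "to_ac a ^ (CARD('a) ^ n) = to_ac a"
    by (metis finite_field_power_card_power_eq_same to_ac_power)
  thus ?case
    using pCons by (simp add: alg_closure_power_card_power_add power_mult_distrib)
qed simp

section \<open>Degree of a root and its Frobenius period\<close>

text \<open>Vanishing coefficients replace \<open>degree p < d\<close> so that the zero polynomial
  is still counted for \<open>d = 0\<close>, where the induction starts.\<close>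

lemma card_polys_coeff_eq_0_above:
  "finite {p :: 'a :: {finite, zero} poly. \<forall>i\<ge>d. Polynomial.coeff p i = 0} \<and>
   card {p :: 'a poly. \<forall>i\<ge>d. Polynomial.coeff p i = 0} = CARD('a) ^ d"
proof (induction d)
  case 0
  have "{p :: 'a poly. \<forall>i\<ge>0. Polynomial.coeff p i = 0} = {0}"
    by (auto intro: poly_eqI)
  thus ?case
    by simp
next
  case (Suc d)
  define T where "T d = {p :: 'a poly. \<forall>i\<ge>d. Polynomial.coeff p i = 0}" for d
  have "T (Suc d) = (\<lambda>(a, p). pCons a p) ` (UNIV \<times> T d)"
  proof (intro equalityI subsetI)
    fix p assume p: "p \<in> T (Suc d)"
    obtain a r where [simp]: "p = pCons a r"
      by (cases p) auto
    have "r \<in> T d"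
      using p unfolding T_def by (auto simp: coeff_pCons split: nat.splits)
    thus "p \<in> (\<lambda>(a, p). pCons a p) ` (UNIV \<times> T d)"
      by auto
  qed (auto simp: T_def coeff_pCons split: nat.splits)
  moreover have "inj_on (\<lambda>(a, p). pCons a p) (UNIV \<times> T d)"
    by (auto intro!: inj_onI)
  ultimately show ?case
    using Suc unfolding T_def[symmetric] by (simp add: card_image card_cartesian_product)
qed

text \<open>The range is the field generated by \<open>x\<close>; the remainders modulo
  \<open>g\<close> represent each of its elements exactly once.\<close>

lemma card_ac_poly_range:
  fixes g :: "'a :: finite_field poly"
  assumes g: "irreducible g" and x: "ac_poly g x = 0"
  shows "finite (range (\<lambda>p :: 'a poly. ac_poly p x))"
    and "card (range (\<lambda>p :: 'a poly. ac_poly p x)) = CARD('a) ^ degree g"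
proof -
  define d where "d = degree g"
  define T where "T = {p :: 'a poly. \<forall>i\<ge>d. Polynomial.coeff p i = 0}"
  have d: "d > 0"
    unfolding d_def by (rule irreducible_degree_pos[OF g])
  have T_iff: "p \<in> T \<longleftrightarrow> degree p < d" for p
  proof
    assume "p \<in> T"
    thus "degree p < d"
      using d by (intro degree_lessI) (auto simp: T_def)
  qed (auto simp: T_def intro: Polynomial.coeff_eq_0)
  have "inj_on (\<lambda>p. ac_poly p x) T"
  proof (rule inj_onI)
    fix p r assume pr: "p \<in> T" "r \<in> T" "ac_poly p x = ac_poly r x"
    have "g dvd p - r"
      using pr(3) irreducible_dvd_iff_root[OF g x, of "p - r"] by simp
    moreover have "p - r \<in> T"
      using pr by (auto simp: T_def)
    ultimately show "p = r"
      using T_iff[of "p - r"] dvd_imp_degree_le[of g "p - r"] by (auto simp: d_def)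
  qed
  moreover have "range (\<lambda>p. ac_poly p x) = (\<lambda>p. ac_poly p x) ` T"
  proof -
    have "p mod g \<in> T" for p
      using d degree_mod_less[of g p] by (cases "g = 0") (auto simp: T_iff d_def)
    hence "ac_poly p x \<in> (\<lambda>p. ac_poly p x) ` T" for p
      using ac_poly_mod[OF x, of p] by (metis imageI)
    thus ?thesis
      by blast
  qed
  ultimately show "finite (range (\<lambda>p :: 'a poly. ac_poly p x))"
    and "card (range (\<lambda>p :: 'a poly. ac_poly p x)) = CARD('a) ^ degree g"
    using card_polys_coeff_eq_0_above[where 'a = 'a, of d]
    by (auto simp: T_def card_image d_def)
qed

text \<open>Fermat's argument: multiplication by a nonzero \<open>x\<close> permutes
  \<open>S - {0}\<close>, so comparing products over this set gives
  \<open>x ^ (card S - 1) = 1\<close>.\<close>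

lemma power_card_eq_same_if_closed:
  fixes S :: "'b :: field set"
  assumes S: "finite S" "0 \<in> S" and x: "x \<in> S" and closed: "\<And>y. y \<in> S \<Longrightarrow> x * y \<in> S"
  shows "x ^ card S = x"
proof (cases "x = 0")
  case False
  have "inj_on ((*) x) (S - {0})"
    using False by (auto intro: inj_onI)
  moreover have "(*) x ` (S - {0}) \<subseteq> S - {0}"
    using False closed by auto
  ultimately have bij: "bij_betw ((*) x) (S - {0}) (S - {0})"
    using S by (simp add: bij_betw_def endo_inj_surj)
  have "\<Prod>(S - {0}) = (\<Prod>y\<in>S - {0}. x * y)"
    using prod.reindex_bij_betw[OF bij, of "\<lambda>y. y"] by simp
  also have "\<dots> = x ^ (card S - 1) * \<Prod>(S - {0})"
    using S by (simp add: prod.distrib)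
  finally have "x ^ (card S - 1) = 1"
    using S by simp
  moreover have "card S = Suc (card S - 1)"
    using S by (metis Suc_pred' card_gt_0_iff empty_iff)
  ultimately show ?thesis
    by (metis mult.right_neutral power_Suc)
qed (use S in \<open>auto simp: power_0_left\<close>)

lemma root_power_card_power_degree:
  fixes g :: "'a :: finite_field poly"
  assumes g: "irreducible g" "ac_poly g x = 0"
  shows "x ^ (CARD('a) ^ degree g) = x"
proof -
  define S where "S = range (\<lambda>p :: 'a poly. ac_poly p x)"
  have "x = ac_poly [:0, 1:] x"
    by simp
  hence x: "x \<in> S"
    unfolding S_def by blast
  have "0 \<in> S"
    unfolding S_def by (metis ac_poly_0 rangeI)
  moreover have "x * y \<in> S" if y: "y \<in> S" for y
  proof -
    obtain p r where "x = ac_poly p x" "y = ac_poly r x"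
      using x y unfolding S_def by blast
    hence "x * y = ac_poly (p * r) x"
      by simp
    thus ?thesis
      unfolding S_def by blast
  qed
  ultimately have "x ^ card S = x"
    using x card_ac_poly_range(1)[OF g] by (intro power_card_eq_same_if_closed) (auto simp: S_def)
  thus ?thesis
    using card_ac_poly_range(2)[OF g] by (simp add: S_def)
qed

text \<open>If the power map fixes \<open>x\<close>, it fixes every element of the field generated
  by \<open>x\<close>. These \<open>q ^ degree g\<close> elements are all roots of
  \<open>X^(q^n) - X\<close>.\<close>

lemma degree_le_if_root_power_card_power:
  fixes g :: "'a :: finite_field poly"
  assumes g: "irreducible g" "ac_poly g x = 0"
    and n: "n > 0" "x ^ (CARD('a) ^ n) = x"
  shows "degree g \<le> n"
proof -
  define q where "q = CARD('a)"
  have q: "q \<ge> 2"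
    unfolding q_def by (rule card_UNIV_field_ge_2)
  define P :: "'a alg_closure poly" where "P = Polynomial.monom 1 (q ^ n) - Polynomial.monom 1 1"
  \<comment> \<open>Ensures that the two monomials of \<open>P\<close> do not cancel; this is where
    \<open>n > 0\<close> enters.\<close>
  have qn: "q ^ n > 1"
    using q n(1) by (intro one_less_power) auto
  have "Polynomial.coeff P (q ^ n) = 1"
    using qn by (simp add: P_def)
  hence P: "P \<noteq> 0"
    by auto
  have "ac_poly p x ^ (q ^ n) = ac_poly p x" for p :: "'a poly"
    using ac_poly_power_card_power[of p x n] n by (simp add: q_def)
  hence "range (\<lambda>p :: 'a poly. ac_poly p x) \<subseteq> {y. poly P y = 0}"
    by (auto simp: P_def poly_monom)
  hence "card (range (\<lambda>p :: 'a poly. ac_poly p x)) \<le> card {y. poly P y = 0}"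
    by (intro card_mono poly_roots_finite P)
  also have "\<dots> \<le> degree P"
    by (rule card_poly_roots_bound[OF P])
  also have "\<dots> \<le> q ^ n"
    unfolding P_def using qn by (intro degree_diff_le order.trans[OF degree_monom_le]) auto
  finally have "q ^ degree g \<le> q ^ n"
    using card_ac_poly_range(2)[OF g] by (simp add: q_def)
  thus ?thesis
    using q by (simp add: power_le_imp_le_exp)
qed

text \<open>Only \<open>n mod d\<close> matters for the Frobenius power, and by the degree bound a
  positive remainder below \<open>d\<close> cannot fix \<open>x\<close>.\<close>

lemma root_power_card_power_eq_iff:
  fixes g :: "'a :: finite_field poly"
  assumes g: "irreducible g" "ac_poly g x = 0"
  shows "x ^ (CARD('a) ^ n) = x \<longleftrightarrow> degree g dvd n"
proof -
  define q where "q = CARD('a)"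
  define d where "d = degree g"
  have d: "d > 0"
    unfolding d_def by (rule irreducible_degree_pos[OF g(1)])
  have mult: "x ^ (q ^ (d * k)) = x" for k
  proof (induction k)
    case (Suc k)
    have "x ^ (q ^ (d * Suc k)) = (x ^ (q ^ d)) ^ (q ^ (d * k))"
      by (simp add: power_add power_mult)
    thus ?case
      using Suc root_power_card_power_degree[OF g] by (simp add: q_def d_def)
  qed simp
  have "x ^ (q ^ n) = x ^ (q ^ (d * (n div d)) * q ^ (n mod d))"
    by (simp only: mult_div_mod_eq flip: power_add)
  also have "\<dots> = x ^ (q ^ (n mod d))"
    by (simp only: power_mult[of x] mult)
  finally have eq: "x ^ (q ^ n) = x ^ (q ^ (n mod d))" .
  show ?thesis
  proof
    assume "x ^ (CARD('a) ^ n) = x"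
    hence "x ^ (q ^ (n mod d)) = x"
      using eq by (simp add: q_def)
    hence "n mod d = 0"
      using degree_le_if_root_power_card_power[OF g, of "n mod d"] mod_less_divisor[OF d, of n]
      by (force simp: q_def d_def)
    thus "degree g dvd n"
      by (auto simp: d_def)
  next
    assume "degree g dvd n"
    thus "x ^ (CARD('a) ^ n) = x"
      using mult by (auto simp: q_def d_def)
  qed
qed

section \<open>Roots of unity of prescribed order\<close>

lemma eq_1_if_coprime_powers_eq_1:
  fixes x :: "'b :: monoid_mult"
  assumes "x ^ a = 1" "x ^ b = 1" "coprime a b"
  shows "x = 1"
proof (cases "a = 0")
  case False
  then obtain u v where "a * u = b * v + gcd a b"
    using bezout_nat by blast
  hence "a * u = b * v + 1"
    using assms(3) by simp
  hence "x ^ (a * u) = x ^ (b * v) * x"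
    by (simp only: power_add power_one_right)
  thus ?thesis
    using assms(1,2) by (simp only: power_mult power_one mult_1_left)
qed (use assms in simp)

text \<open>Take a root of \<open>1 + w + ... + w^(p-1)\<close>: it satisfies
  \<open>w^p = 1\<close>, and \<open>w = 1\<close> would make \<open>p\<close> vanish in the
  field.\<close>

lemma nontrivial_prime_root_of_unity_exists:
  assumes "prime p" "of_nat p \<noteq> (0 :: 'b :: alg_closed_field)"
  obtains w :: "'b :: alg_closed_field" where "w ^ p = 1" "w \<noteq> 1"
proof -
  have p: "p \<ge> 2"
    using assms(1) by (rule prime_ge_2_nat)
  obtain w :: 'b where "(\<Sum>k\<le>p - 1. 1 * w ^ k) = 0"
    using alg_closed[of "p - 1" "\<lambda>_. 1 :: 'b"] p by auto
  moreover have "{..p - 1} = {..<p}"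
    using p by auto
  ultimately have w: "(\<Sum>k<p. w ^ k) = 0"
    by simp
  have "w ^ p = 1"
    using power_diff_1_eq[of w p] w by simp
  moreover have "w \<noteq> 1"
    using w assms(2) by auto
  ultimately show ?thesis
    using that by blast
qed

text \<open>Induction on \<open>N = p * n\<close>: a suitable \<open>p\<close>-th root of an element
  of order \<open>n\<close> has order \<open>N\<close>.\<close>

lemma primitive_root_of_unity_exists:
  assumes "of_nat N \<noteq> (0 :: 'b :: alg_closed_field)"
  obtains z :: "'b :: alg_closed_field" where "\<And>k. z ^ k = 1 \<longleftrightarrow> N dvd k"
proof -
  have "\<exists>z :: 'b. \<forall>k. z ^ k = 1 \<longleftrightarrow> N dvd k"
    using assms
  proof (induction N rule: less_induct)
    case (less N)
    show ?case
    proof (cases "N = 1")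
      case True
      thus ?thesis
        by (intro exI[of _ 1]) auto
    next
      case False
      then obtain p where p: "prime p" "p dvd N"
        using prime_factor_nat by blast
      then obtain n where N: "N = p * n"
        by (auto elim: dvdE)
      have p2: "p \<ge> 2"
        using p(1) by (rule prime_ge_2_nat)
      have n: "n > 0"
        using less.prems N by (cases n) auto
      have "n < N"
        using N p2 n by simp
      moreover have nz: "of_nat n \<noteq> (0 :: 'b)" "of_nat p \<noteq> (0 :: 'b)"
        using less.prems N by auto
      ultimately obtain z :: 'b where z: "\<And>k. z ^ k = 1 \<longleftrightarrow> n dvd k"
        using less.IH by blast
      obtain w :: 'b where w: "w ^ p = 1" "w \<noteq> 1"
        using nontrivial_prime_root_of_unity_exists[OF p(1) nz(2)] .
      \<comment> \<open>Otherwise \<open>y\<close> and \<open>y * w\<close> both have trivial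
        \<open>n\<close>-th power, hence so does \<open>w\<close>. Then \<open>p\<close> divides
        \<open>n\<close>, and \<open>z\<close> would have order at most
        \<open>n / p\<close>.\<close>
      have "\<exists>y. y ^ p = z \<and> y ^ n \<noteq> 1"
      proof (rule ccontr)
        assume *: "\<not> ?thesis"
        obtain y where y: "y ^ p = z"
          using nth_root_exists[of p z] p2 by auto
        have "(y * w) ^ p = z"
          using y w by (simp add: power_mult_distrib)
        hence yn: "y ^ n = 1" and "(y * w) ^ n = 1"
          using * y by auto
        hence "w ^ n = 1"
          by (simp add: power_mult_distrib)
        hence "p dvd n"
          using eq_1_if_coprime_powers_eq_1[OF w(1), of n] w(2) prime_imp_coprime[OF p(1)] by blast
        then obtain j where j: "n = p * j"
          by (auto elim: dvdE)
        have "z ^ j = 1"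
          using yn y j by (simp add: power_mult)
        hence "n dvd j"
          using z by simp
        thus False
          using j n p2 by (auto dest: dvd_imp_le)
      qed
      then obtain y where y: "y ^ p = z" "y ^ n \<noteq> 1"
        by blast
      have "y ^ k = 1 \<longleftrightarrow> N dvd k" for k
      proof
        assume yk: "y ^ k = 1"
        have "z ^ k = (y ^ k) ^ p"
          by (simp add: y(1)[symmetric] mult.commute flip: power_mult)
        hence "n dvd k"
          using z yk by simp
        then obtain j where j: "k = n * j"
          by (auto elim: dvdE)
        have "(y ^ n) ^ p = z ^ n"
          by (simp add: y(1)[symmetric] mult.commute flip: power_mult)
        hence "(y ^ n) ^ p = 1"
          using z[of n] by simp
        moreover have "(y ^ n) ^ j = 1"
          using yk j by (simp add: power_mult)
        \<comment> \<open>If \<open>p\<close> and \<open>j\<close> were coprime,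
          \<open>y ^ n\<close> would be 1.\<close>
        ultimately have "p dvd j"
          using eq_1_if_coprime_powers_eq_1[of "y ^ n" p j] y(2) prime_imp_coprime[OF p(1)] by blast
        thus "N dvd k"
          using N j by (simp add: mult.commute)
      next
        assume "N dvd k"
        then obtain j where "k = p * (n * j)"
          using N by (metis dvdE mult.assoc)
        hence "y ^ k = z ^ (n * j)"
          using y by (simp add: power_mult)
        thus "y ^ k = 1"
          using z by simp
      qed
      thus ?thesis
        by blast
    qed
  qed
  thus ?thesis
    using that by blast
qed

section \<open>Bounds for the multiplicative order\<close>

lemma cong_power_1_iff:
  fixes q :: nat
  assumes "q > 0"
  shows "[q ^ n = 1] (mod r) \<longleftrightarrow> r dvd q ^ n - 1"
  using assms cong_altdef_nat[of 1 "q ^ n" r] by simp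

text \<open>
  With \<open>s k = 1 + Q + \<dots> + Q^(k-1)\<close>, the residues of \<open>s 0, \<dots>, s t\<close> modulo \<open>t\<close> collide,
  and \<open>s j - s i = Q^i * s (j - i)\<close>.
\<close>
lemma dvd_power_minus_1_exists:
  fixes Q t :: nat
  assumes "coprime t Q" "t > 0" "Q > 0"
  obtains k where "0 < k" "k \<le> t" "(Q - 1) * t dvd Q ^ k - 1"
proof -
  define s where "s k = (\<Sum>i<k. Q ^ i)" for k
  have "\<not> inj_on (\<lambda>k. s k mod t) {..t}"
  proof
    assume "inj_on (\<lambda>k. s k mod t) {..t}"
    hence "card {..t} \<le> card {..<t}"
      by (rule card_inj_on_le) (use assms in auto)
    thus False
      by simp
  qed
  then obtain i j where ij: "i < j" "j \<le> t" "s i mod t = s j mod t"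
    unfolding inj_on_def by (metis atMost_iff linorder_neqE_nat)
  have s_add: "s (a + b) = s a + Q ^ a * s b" for a b
    by (induction b) (simp_all add: s_def algebra_simps power_add)
  have "s j = s i + Q ^ i * s (j - i)"
    using s_add[of i "j - i"] ij by simp
  moreover have "t dvd s j - s i"
    using mod_eq_dvd_iff_nat[of "s i" "s j" t] ij calculation by simp
  ultimately have "t dvd Q ^ i * s (j - i)"
    by simp
  hence "t dvd s (j - i)"
    using assms(1) by (simp add: coprime_dvd_mult_right_iff)
  moreover have "Q ^ k - 1 = (Q - 1) * s k" for k
  proof -
    have "Suc ((Q - 1) * s k) = Q ^ k"
    proof (induction k)
      case (Suc k)
      obtain Q' where [simp]: "Q = Suc Q'"
        using assms(3) gr0_implies_Suc by blast
      have "Suc ((Q - 1) * s (Suc k)) = Suc ((Q - 1) * s k) + (Q - 1) * Q ^ k"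
        by (simp add: s_def algebra_simps)
      thus ?case
        using Suc by simp
    qed (simp add: s_def)
    thus ?thesis
      by simp
  qed
  ultimately show ?thesis
    using ij by (intro that[of "j - i"]) auto
qed

text \<open>With \<open>Q = q ^ m\<close>, the pigeonhole bound yields \<open>k \<le> t\<close> such
  that the order divides \<open>m * k\<close>.\<close>

lemma ord_le:
  fixes q m t :: nat
  assumes "coprime t q" "m > 0" "t > 0" "q > 0"
  shows "ord ((q ^ m - 1) * t) q \<le> m * t"
proof -
  obtain k where k: "0 < k" "k \<le> t" "(q ^ m - 1) * t dvd (q ^ m) ^ k - 1"
    using dvd_power_minus_1_exists[of t "q ^ m"] assms by auto
  hence "ord ((q ^ m - 1) * t) q dvd m * k"
    using assms(4) by (metis cong_power_1_iff ord_divides power_mult)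
  hence "ord ((q ^ m - 1) * t) q \<le> m * k"
    using assms(2) k(1) by (intro dvd_imp_le) auto
  also have "\<dots> \<le> m * t"
    using k by simp
  finally show ?thesis .
qed

text \<open>Rules out the value 0 that \<open>ord\<close> takes without coprimality:
  \<open>q\<close> is prime to both \<open>q ^ m - 1\<close> and \<open>t\<close>.\<close>

lemma ord_pos:
  fixes q m t :: nat
  assumes "coprime t q" "m > 0" "q > 0"
  shows "ord ((q ^ m - 1) * t) q > 0"
proof -
  have "coprime (q ^ m - 1) (q ^ m)"
    using assms(3) by (intro coprime_diff_one_left_nat) simp
  hence "coprime (q ^ m - 1) q"
    using assms(2) coprime_power_right_iff[of "q ^ m - 1" q m] by simp
  thus ?thesis
    using assms(1) by simp
qed

lemma power_power_eq_iff:
  fixes x :: "'b :: field"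
  assumes "x \<noteq> 0" "q > 0"
  shows "x ^ (q ^ n) = x \<longleftrightarrow> x ^ (q ^ n - 1) = 1"
proof -
  have "x ^ (q ^ n) = x * x ^ (q ^ n - 1)"
    using assms(2) by (metis Suc_pred' power_Suc zero_less_power)
  thus ?thesis
    using assms(1) by simp
qed

text \<open>Makes a primitive root of unity of this order available. The characteristic divides
  \<open>q ^ m\<close>, hence not \<open>q ^ m - 1\<close>, and coprimality keeps it from dividing
  \<open>t\<close>.\<close>

lemma of_nat_power_card_minus_1_mult_neq_0:
  assumes "coprime t CARD('a :: finite_field)" "m > 0"
  shows "of_nat ((CARD('a) ^ m - 1) * t) \<noteq> (0 :: 'a)"
proof
  define p where "p = CHAR('a)"
  assume "of_nat ((CARD('a) ^ m - 1) * t) = (0 :: 'a)"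
  hence "p dvd (CARD('a) ^ m - 1) * t"
    by (simp only: of_nat_eq_0_iff_char_dvd p_def)
  moreover have p: "prime p" "p dvd CARD('a)"
    by (simp_all add: p_def CHAR_dvd_CARD)
  ultimately consider "p dvd CARD('a) ^ m - 1" | "p dvd t"
    by (auto simp: prime_dvd_mult_iff)
  thus False
  proof cases
    case 1
    have "p dvd CARD('a) ^ m"
      using p assms(2) by (simp add: prime_dvd_power_iff)
    hence "p dvd 1"
      using 1 by (metis dvd_diffD1 finite_UNIV_card_ge_0 finite_class.finite_UNIV
        less_eq_Suc_le One_nat_def zero_less_power)
    thus False
      using p(1) by simp
  next
    case 2
    thus False
      using p assms(1) by (metis coprime_common_divisor not_prime_unit)
  qed
qed

section \<open>Exponents divisible by the characteristic\<close>

lemma alg_closure_CHAR_power_inject: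
  fixes x y :: "'a :: finite_field alg_closure"
  assumes "x ^ CHAR('a) = y ^ CHAR('a)"
  shows "x = y"
proof -
  have "((x - y) + y) ^ CHAR('a) = (x - y) ^ CHAR('a) + y ^ CHAR('a)"
    by (rule freshmans_dream) simp_all
  hence "(x - y) ^ CHAR('a) = 0"
    using assms by simp
  thus ?thesis
    by simp
qed

text \<open>Cancelling one Frobenius shows that \<open>x ^ s\<close> already has degree at most
  \<open>degree f\<close>; then \<open>g\<close> divides \<open>h(X^s)\<close> for its minimal
  polynomial \<open>h\<close>.\<close>

lemma degree_le_if_CHAR_dvd:
  fixes f g :: "'a :: finite_field poly"
  assumes f: "irreducible f" and g: "irreducible g"
    and dvd: "g dvd pcompose f (Polynomial.monom 1 (CHAR('a) * s))" and s: "s > 0"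
  shows "degree g \<le> degree f * s"
proof -
  obtain x where x: "ac_poly g x = 0"
    using irreducible_has_root[OF g] .
  have "ac_poly (pcompose f (Polynomial.monom 1 (CHAR('a) * s))) x = 0"
    using irreducible_dvd_iff_root[OF g x] dvd by blast
  hence "ac_poly f (x ^ (CHAR('a) * s)) = 0"
    by (simp add: ac_poly_pcompose)
  hence "(x ^ (CHAR('a) * s)) ^ (CARD('a) ^ degree f) = x ^ (CHAR('a) * s)"
    by (rule root_power_card_power_degree[OF f])
  hence "((x ^ s) ^ (CARD('a) ^ degree f)) ^ CHAR('a) = (x ^ s) ^ CHAR('a)"
    by (simp add: mult_ac flip: power_mult)
  hence y: "(x ^ s) ^ (CARD('a) ^ degree f) = x ^ s"
    by (rule alg_closure_CHAR_power_inject)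
  obtain h :: "'a poly" where h: "irreducible h" "\<And>p. ac_poly p (x ^ s) = 0 \<longleftrightarrow> h dvd p"
    using minimal_polynomial_exists[of "x ^ s"] by blast
  have "degree h \<le> degree f"
    using degree_le_if_root_power_card_power[OF h(1) _ _ y] h(2) irreducible_degree_pos[OF f] by simp
  moreover have "g dvd pcompose h (Polynomial.monom 1 s)"
    using h(2)[of h] by (simp add: ac_poly_pcompose flip: irreducible_dvd_iff_root[OF g x])
  moreover have deg: "degree (pcompose h (Polynomial.monom 1 s)) = degree h * s"
    by (simp add: degree_pcompose degree_monom_eq)
  \<comment> \<open>Shows that \<open>h(X^s)\<close> is nonzero, so that divisibility bounds the
    degree of \<open>g\<close>.\<close>
  moreover have "degree h * s > 0"
    using irreducible_degree_pos[OF h(1)] s by simp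
  ultimately show ?thesis
    by (metis dvd_imp_degree_le degree_0 less_numeral_extra(3) mult_le_mono1 order.trans)
qed

section \<open>Large-degree factors of \<open>f(x^t)\<close>\<close>

theorem theorem1p1:
  fixes q m t e :: nat
  assumes "q = CARD('a :: finite_field)"
    and "m > 0" and "t > 0" and "e > 0"
    and "real e > real m * real t / 2"
  shows "(\<exists>f :: 'a poly. irreducible f \<and> degree f = m \<and>
            (\<exists>g :: 'a poly. irreducible g \<and> g dvd pcompose f (Polynomial.monom 1 t) \<and> degree g = e))
     \<longleftrightarrow> gcd t q = 1 \<and> ord ((q ^ m - 1) * t) q = e"
proof -
  define R where "R = (q ^ m - 1) * t"
  have q: "q \<ge> 2"
    unfolding assms(1) by (rule card_UNIV_field_ge_2)
  have "real (2 * e) > real (m * t)"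
    using assms(5) by simp
  hence e: "2 * e > m * t"
    by (simp only: of_nat_less_iff)
  have ord_dvd_iff: "ord R q dvd n \<longleftrightarrow> R dvd q ^ n - 1" for n
    using q cong_power_1_iff[of q n R] ord_divides[of q n R] by simp
  show ?thesis
  proof
    assume "\<exists>f :: 'a poly. irreducible f \<and> degree f = m \<and>
            (\<exists>g :: 'a poly. irreducible g \<and> g dvd pcompose f (Polynomial.monom 1 t) \<and> degree g = e)"
    then obtain f g :: "'a poly" where f: "irreducible f" "degree f = m"
      and g: "irreducible g" "g dvd pcompose f (Polynomial.monom 1 t)" "degree g = e"
      by blast
    have cop: "coprime t q"
    proof (rule ccontr)
      assume "\<not> coprime t q"
      then obtain l where l: "prime l" "l dvd t" "l dvd q"
        by (metis coprime_iff_gcd_eq_1 dvd_trans gcd_dvd1 gcd_dvd2 prime_factor_nat)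
      hence "l = CHAR('a)"
        using prime_dvd_CARD_imp_eq_CHAR assms(1) by blast
      then obtain s where s: "t = CHAR('a) * s"
        using l by (auto elim: dvdE)
      have "e \<le> m * s"
        using degree_le_if_CHAR_dvd[OF f(1) g(1), of s] f(2) g(2,3) assms(3) s by auto
      hence "2 * e \<le> CHAR('a) * (m * s)"
        using prime_ge_2_nat[OF CHAR_prime[where 'a = 'a]] by (intro mult_mono) auto
      thus False
        using e s by (simp add: mult_ac)
    qed
    obtain x where x: "ac_poly g x = 0"
      using irreducible_has_root[OF g(1)] .
    have e_dvd_iff: "x ^ (q ^ n) = x \<longleftrightarrow> e dvd n" for n
      using root_power_card_power_eq_iff[OF g(1) x] g(3) assms(1) by simp
    have "ac_poly (pcompose f (Polynomial.monom 1 t)) x = 0"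
      using irreducible_dvd_iff_root[OF g(1) x] g(2) by blast
    hence "ac_poly f (x ^ t) = 0"
      by (simp add: ac_poly_pcompose)
    hence xt: "(x ^ t) ^ (q ^ m) = x ^ t"
      using root_power_card_power_degree[OF f(1)] f(2) assms(1) by simp
    have "x ^ (q ^ ord R q) = x"
    \<comment> \<open>The root 0 arises when \<open>g\<close> is associated with \<open>X\<close>;
      there \<open>x ^ R = 1\<close> fails, but the claim is immediate.\<close>
    proof (cases "x = 0")
      case False
      have "x ^ R = (x ^ t) ^ (q ^ m - 1)"
        by (simp only: R_def mult.commute[of _ t] power_mult)
      also have "\<dots> = 1"
        using xt False q by (simp add: power_power_eq_iff)
      finally have "x ^ R = 1" .
      moreover have "R dvd q ^ ord R q - 1"
        using ord_dvd_iff[of "ord R q"] by (metis dvd_refl)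
      ultimately show ?thesis
        using False q by (metis dvdE pos2 order.strict_trans2 power_mult power_one power_power_eq_iff)
    qed (use q in \<open>simp add: power_0_left\<close>)
    hence "e dvd ord R q"
      by (simp add: e_dvd_iff)
    then obtain k where k: "ord R q = e * k"
      by (auto elim: dvdE)
    have "e * k \<le> m * t"
      using ord_le[OF cop assms(2,3)] q k by (simp add: R_def)
    hence "e * k < e * 2"
      using e by linarith
    \<comment> \<open>Excludes \<open>k = 0\<close>; together with \<open>k < 2\<close> this leaves
      only \<open>k = 1\<close>.\<close>
    moreover have "e * k > 0"
    proof -
      have "ord R q > 0"
        unfolding R_def by (rule ord_pos[OF cop assms(2)]) (use q in simp)
      thus ?thesis
        by (simp only: k)
    qed
    ultimately have "k = 1"
      by auto
    thus "gcd t q = 1 \<and> ord ((q ^ m - 1) * t) q = e"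
      using cop k by (simp add: R_def)
  next
    assume *: "gcd t q = 1 \<and> ord ((q ^ m - 1) * t) q = e"
    hence cop: "coprime t q"
      using coprime_iff_gcd_eq_1 by blast
    have "of_nat R \<noteq> (0 :: 'a)"
      using of_nat_power_card_minus_1_mult_neq_0[of t m, where 'a = 'a] cop assms(2)
      unfolding R_def assms(1) by blast
    hence "of_nat R \<noteq> (0 :: 'a alg_closure)"
      by (metis to_ac_eq_0_iff to_ac_of_nat)
    then obtain z :: "'a alg_closure" where z: "\<And>k. z ^ k = 1 \<longleftrightarrow> R dvd k"
      using primitive_root_of_unity_exists by blast
    have "R > 0"
      using \<open>of_nat R \<noteq> (0 :: 'a)\<close> by (cases R) auto
    hence z0: "z \<noteq> 0"
      using z[of R] by (auto simp: power_0_left)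
    obtain f :: "'a poly" where f: "irreducible f" "\<And>p. ac_poly p (z ^ t) = 0 \<longleftrightarrow> f dvd p"
      using minimal_polynomial_exists[of "z ^ t"] by blast
    obtain g :: "'a poly" where g: "irreducible g" "\<And>p. ac_poly p z = 0 \<longleftrightarrow> g dvd p"
      using minimal_polynomial_exists[of z] by blast
    \<comment> \<open>Two naturals with the same multiples are equal.\<close>
    have "degree g dvd n \<longleftrightarrow> e dvd n" for n
    proof -
      have "degree g dvd n \<longleftrightarrow> z ^ (q ^ n) = z"
        using root_power_card_power_eq_iff[OF g(1)] g(2) assms(1) by simp
      also have "\<dots> \<longleftrightarrow> R dvd q ^ n - 1"
        using z z0 q by (simp add: power_power_eq_iff)
      finally show ?thesis
        using * ord_dvd_iff by (simp add: R_def)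
    qed
    hence "degree g = e"
      by (metis dvd_antisym dvd_refl)
    moreover have "degree f = m"
    proof -
      \<comment> \<open>\<open>z ^ t\<close> has order \<open>q ^ m - 1\<close>, as \<open>t\<close>
        cancels from \<open>R\<close>. Taking \<open>n = m\<close> and \<open>n = degree f\<close>
        then bounds the degree from both sides.\<close>
      have "degree f dvd n \<longleftrightarrow> q ^ m - 1 dvd q ^ n - 1" for n
      proof -
        have "degree f dvd n \<longleftrightarrow> (z ^ t) ^ (q ^ n) = z ^ t"
          using root_power_card_power_eq_iff[OF f(1)] f(2) assms(1) by simp
        also have "\<dots> \<longleftrightarrow> (z ^ t) ^ (q ^ n - 1) = 1"
          using z0 q by (simp add: power_power_eq_iff)
        also have "\<dots> \<longleftrightarrow> R dvd t * (q ^ n - 1)"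
          using z by (simp flip: power_mult)
        finally show ?thesis
          using assms(3) by (simp add: R_def mult.commute)
      qed
      note iff = this
      have d: "degree f > 0"
        using irreducible_degree_pos[OF f(1)] .
      have "degree f \<le> m"
        using iff[of m] assms(2) by (simp add: dvd_imp_le)
      moreover have gt: "q ^ degree f > 1"
        using q d by (intro one_less_power) auto
      have "q ^ m - 1 \<le> q ^ degree f - 1"
        using iff[of "degree f"] gt by (intro dvd_imp_le) auto
      hence "q ^ m \<le> q ^ degree f"
        using gt by linarith
      hence "m \<le> degree f"
        using q by (simp add: power_le_imp_le_exp)
      ultimately show ?thesis
        by simp
    qed
    moreover have "g dvd pcompose f (Polynomial.monom 1 t)"
      using f(2)[of f] by (simp add: ac_poly_pcompose flip: g(2))
    ultimately show "\<exists>f :: 'a poly. irreducible f \<and> degree f = m \<and>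
            (\<exists>g :: 'a poly. irreducible g \<and> g dvd pcompose f (Polynomial.monom 1 t) \<and> degree g = e)"
      using f(1) g(1) by blast
  qed
qed

end
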